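(* Let $\mathcal Q$ be a 2-dimensional space form given by a space form vector $\mathfrak q$. Any discrete curve $f\in\mathcal C_{\mathcal Q}(\eta)$ satisfies, at every vertex, the two Frenet-type equations $$\frac1\eta\{\mathfrak t_{\bar10}-\mathfrak t_{01}\}=-\frac{\kappa_0}{2}\{\mathfrak n_{\bar10}+\mathfrak n_{01}-2\mathfrak p\}=-\frac{\kappa_0}{2\eta}\{\mathfrak f_{\bar1}-\mathfrak f_1\},$$ $$\frac1\eta\{\mathfrak n_{\bar10}-\mathfrak n_{01}-\eta(\langle\langle\mathfrak q,\mathfrak q\rangle\rangle\mathfrak f_0+\mathfrak q)\}=\frac{\kappa_0}{2}\Bigl(1+\frac{\langle\langle\mathfrak q,\mathfrak q\rangle\rangle}{4}\eta^2\Bigr)\{\mathfrak t_{\bar10}+\mathfrak t_{01}-2\mathfrak p\}.$$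
   Context: **Light cone model.** $\mathbb R^{3,2}$ is $\mathbb R^5$ with the inner product $\langle\langle x,y\rangle\rangle=x_1y_1+x_2y_2+x_3y_3-x_4y_4-x_5y_5$, and $\mathfrak p=(0,0,0,0,1)$. Points, oriented circles and oriented lines of $\mathbb R^2\cup\{\infty\}$ correspond to null lines $\mathbb R\mathfrak v$, $\mathfrak v\neq0$, $\langle\langle\mathfrak v,\mathfrak v\rangle\rangle=0$: the point $(x,y)$ to $(x,y,\frac12(1-x^2-y^2),\frac12(1+x^2+y^2),0)$, the oriented circle with center $(x,y)$ and radius $r\in\mathbb{R}\setminus\{0\}$ to $(x,y,\frac12(1-x^2-y^2+r^2),\frac12(1+x^2+y^2-r^2),r)$, the oriented line with unit normal $(x,y)$ and normal distance $d$ to $(x,y,-d,d,1)$, and $\infty$ to $(0,0,1,-1,0)$. Points are the null lines orthogonal to $\mathfrak p$. Two elements are in oriented contact (tangency with orientation, or incidence) iff their inner product vanishes. **Space forms.** A space form $\mathcal Q$ is given by a vector $\mathfrak q\neq0$ with $\langle\langle\mathfrak p,\mathfrak q\rangle\rangle=0$; its sectional curvature is $-\langle\langle\mathfrak q,\mathfrak q\rangle\rangle$. The geodesic curvature of a circle $\mathfrak s$ is $\langle\langle\mathfrak s,\mathfrak q\rangle\rangle/\langle\langle\mathfrak s,\mathfrak p\rangle\rangle$; geodesics are circles with $\langle\langle\mathfrak s,\mathfrak q\rangle\rangle=0$. **Curves.** $\mathcal V=\mathbb Z$ with edges between consecutive integers; $f_{\bar1},f_0,f_1$ denote values at three consecutive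 vertices, subscripts $\bar10,01$ the edges between them. $\mathcal C_{\mathcal Q}$ is the set of discrete curves $f:\mathcal V\to\mathcal Q$ with constant distance in $\mathcal Q$ between consecutive points, any three consecutive points pairwise distinct, all points on one side of the hyperbolic boundary if the curvature is negative, consecutive points not antipodal if it is positive, together with consistently oriented geodesic edges. The point $f$ is lifted to $\mathfrak f$ with $\langle\langle\mathfrak f,\mathfrak q\rangle\rangle=-1$; the oriented geodesic through $f_0,f_1$ is lifted to the null vector $\mathfrak t_{01}$ with $\langle\langle\mathfrak t_{01},\mathfrak p\rangle\rangle=-1$, $\langle\langle\mathfrak t_{01},\mathfrak q\rangle\rangle=\langle\langle\mathfrak t_{01},\mathfrak f_0\rangle\rangle=\langle\langle\mathfrak t_{01},\mathfrak f_1\rangle\rangle=0$. Consistent orientation means that at each vertex there is a circle (the double-curvature circle, represented by a null vector $\mathfrak c_0$ normalized to $\langle\langle\mathfrak c_0,\mathfrak p\rangle\rangle=-1$) that is in oriented contact with the geodesic edges at $f_{\bar1}$ and $f_1$, i.e. $\mathfrak c_0\in\mathfrak t_{\bar10}+\mathbb R\mathfrak f_{\bar1}$ and $\mathfrak c_0\in\mathfrak t_{01}+\mathbb R\mathfrak f_1$. The geodesic curvature $\kappa_0$ of $f$ at $f_0$ is twice the geodesic curvature of $\mathfrak c_0$. $\mathcal C_{\mathcal Q}(\eta)$, $\eta>0$, is the set of $f\in\mathcal C_{\mathcal Q}$ with $\eta^2=-2\langle\langle\mathfrak f_0,\mathfrak f_1\rangle\rangle$ (a constant along the curve). Edge-normals: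 $\mathfrak n_{01}=\frac1\eta(\mathfrak f_0-\mathfrak f_1)+\mathfrak p$. *)

theory Defs
  imports "HOL-Analysis.Analysis"
begin

section \<open>The light cone model of Lie circle geometry\<close>

definition lie_inner :: "real^5 \<Rightarrow> real^5 \<Rightarrow> real"  (\<open>\<llangle>_,/ _\<rrangle>\<close>)
  where "\<llangle>x, y\<rrangle> = x$1 * y$1 + x$2 * y$2 + x$3 * y$3 - x$4 * y$4 - x$5 * y$5"

definition pp :: "real^5"
  where "pp = axis 5 1"

text \<open>Points, oriented circles and oriented lines are null lines in this space. Points are the
  null lines orthogonal to \<^const>\<open>pp\<close>; every null line not orthogonal to \<^const>\<open>pp\<close> (an oriented
  circle or line) contains exactly one vector \<open>s\<close> with \<open>\<llangle>s, pp\<rrangle> = -1\<close>.  Below, points and circles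
  are represented by such normalized vectors.\<close>

definition null_vector :: "real^5 \<Rightarrow> bool"
  where "null_vector v \<longleftrightarrow> v \<noteq> 0 \<and> \<llangle>v, v\<rrangle> = 0"

definition circle_lift :: "real^5 \<Rightarrow> bool"
  where "circle_lift s \<longleftrightarrow> null_vector s \<and> \<llangle>s, pp\<rrangle> = -1"


section \<open>Space forms\<close>

definition space_form_vector :: "real^5 \<Rightarrow> bool"
  where "space_form_vector q \<longleftrightarrow> q \<noteq> 0 \<and> \<llangle>pp, q\<rrangle> = 0"

definition sectional_curvature :: "real^5 \<Rightarrow> real"
  where "sectional_curvature q = - \<llangle>q, q\<rrangle>"

text \<open>A point of the space form is identified with its unique lift normalized against \<open>q\<close>.
  If the curvature is negative, this set has two components (one on each side of the
  hyperbolic boundary, whose points are the null lines orthogonal to \<open>q\<close>).\<close>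

definition space_form :: "real^5 \<Rightarrow> (real^5) set"
  where "space_form q = {v. null_vector v \<and> \<llangle>v, pp\<rrangle> = 0 \<and> \<llangle>v, q\<rrangle> = -1}"

text \<open>Let \<open>k \<noteq> 0\<close> be the curvature. The component of a point \<open>v\<close> orthogonal to \<open>q\<close> is \<open>v - q / k\<close>,
  and it lies on the quadric \<open>\<llangle>x, x\<rrangle> = 1 / k\<close> in a space of signature \<open>(3,0)\<close> or \<open>(2,1)\<close>. The inner
  product of two such components is \<open>\<llangle>v, w\<rrangle> + 1 / k\<close>, and this equals \<open>cos (sqrt k * d) / k\<close> on the
  sphere and \<open>cosh (sqrt (-k) * d) / k\<close> on a sheet of the hyperboloid, where \<open>d\<close> is the intrinsic
  distance. For \<open>k = 0\<close>, \<open>-2 * \<llangle>v, w\<rrangle>\<close> is the squared Euclidean distance.\<close>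

definition space_form_dist :: "real^5 \<Rightarrow> real^5 \<Rightarrow> real^5 \<Rightarrow> real"
  where "space_form_dist q v w =
    (let k = sectional_curvature q in
       if k > 0 then arccos (1 + k * \<llangle>v, w\<rrangle>) / sqrt k
       else if k < 0 then arcosh (1 + k * \<llangle>v, w\<rrangle>) / sqrt (- k)
       else sqrt (-2 * \<llangle>v, w\<rrangle>))"

definition antipodal :: "real^5 \<Rightarrow> real^5 \<Rightarrow> real^5 \<Rightarrow> bool"
  where "antipodal q v w \<longleftrightarrow>
    sectional_curvature q > 0 \<and> space_form_dist q v w = pi / sqrt (sectional_curvature q)"

text \<open>A null vector \<open>v \<noteq> 0\<close> orthogonal to \<^const>\<open>pp\<close> has \<open>v$4 \<noteq> 0\<close>, so the points correspond to the
  unit sphere \<open>v$4 = 1\<close> (the conformal 2-sphere). The hyperbolic boundary is the circle on it where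
  \<open>\<llangle>\<cdot>, q\<rrangle>\<close> vanishes, and the sign of \<open>\<llangle>\<cdot>, q\<rrangle>\<close> on this sphere tells its two sides apart.\<close>

definition same_side :: "real^5 \<Rightarrow> real^5 \<Rightarrow> real^5 \<Rightarrow> bool"
  where "same_side q v w \<longleftrightarrow> \<llangle>(1 / v$4) *\<^sub>R v, q\<rrangle> * \<llangle>(1 / w$4) *\<^sub>R w, q\<rrangle> > 0"

definition geodesic_curvature_circle :: "real^5 \<Rightarrow> real^5 \<Rightarrow> real"
  where "geodesic_curvature_circle q s = \<llangle>s, q\<rrangle> / \<llangle>s, pp\<rrangle>"

definition geodesic_through :: "real^5 \<Rightarrow> real^5 \<Rightarrow> real^5 \<Rightarrow> real^5 \<Rightarrow> bool"
  where "geodesic_through q v w s \<longleftrightarrow>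
    circle_lift s \<and> \<llangle>s, q\<rrangle> = 0 \<and> \<llangle>s, v\<rrangle> = 0 \<and> \<llangle>s, w\<rrangle> = 0"


section \<open>Discrete curves\<close>

text \<open>A discrete curve is given by its vertices \<open>f\<close> and its oriented geodesic edges \<open>t\<close>;
  \<open>t i\<close> is the edge between the vertices \<open>i\<close> and \<open>i + 1\<close>.\<close>

definition double_curvature_circle ::
    "(int \<Rightarrow> real^5) \<Rightarrow> (int \<Rightarrow> real^5) \<Rightarrow> int \<Rightarrow> real^5 \<Rightarrow> bool"
  where "double_curvature_circle f t i c \<longleftrightarrow>
    circle_lift c \<and>
    (\<exists>a. c = t (i - 1) + a *\<^sub>R f (i - 1)) \<and>
    (\<exists>b. c = t i + b *\<^sub>R f (i + 1))"

definition discrete_curves :: "real^5 \<Rightarrow> ((int \<Rightarrow> real^5) \<times> (int \<Rightarrow> real^5)) set"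
  where "discrete_curves q = {(f, t).
    (\<forall>i. f i \<in> space_form q) \<and>
    (\<exists>d. \<forall>i. space_form_dist q (f i) (f (i + 1)) = d) \<and>
    (\<forall>i. f (i - 1) \<noteq> f i \<and> f i \<noteq> f (i + 1) \<and> f (i - 1) \<noteq> f (i + 1)) \<and>
    (sectional_curvature q < 0 \<longrightarrow> (\<forall>i j. same_side q (f i) (f j))) \<and>
    (sectional_curvature q > 0 \<longrightarrow> (\<forall>i. \<not> antipodal q (f i) (f (i + 1)))) \<and>
    (\<forall>i. geodesic_through q (f i) (f (i + 1)) (t i)) \<and>
    (\<forall>i. \<exists>c. double_curvature_circle f t i c)}"

definition discrete_curves_eta ::
    "real^5 \<Rightarrow> real \<Rightarrow> ((int \<Rightarrow> real^5) \<times> (int \<Rightarrow> real^5)) set"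
  where "discrete_curves_eta q \<eta> =
    {(f, t) \<in> discrete_curves q. \<forall>i. \<eta>\<^sup>2 = -2 * \<llangle>f i, f (i + 1)\<rrangle>}"

definition curvature :: "real^5 \<Rightarrow> (int \<Rightarrow> real^5) \<Rightarrow> (int \<Rightarrow> real^5) \<Rightarrow> int \<Rightarrow> real"
  where "curvature q f t i =
    2 * geodesic_curvature_circle q (THE c. double_curvature_circle f t i c)"

definition edge_normal :: "real \<Rightarrow> (int \<Rightarrow> real^5) \<Rightarrow> int \<Rightarrow> real^5"
  where "edge_normal \<eta> f i = (1 / \<eta>) *\<^sub>R (f i - f (i + 1)) + pp"

text \<open>The definite description in \<^const>\<open>curvature\<close> is well-defined: the normalized lifts
  \<open>f (i - 1)\<close> and \<open>f (i + 1)\<close> of distinct points are linearly independent.\<close>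

lemma lie_inner_scale_left: "\<llangle>a *\<^sub>R x, y\<rrangle> = a * \<llangle>x, y\<rrangle>"
  by (simp add: lie_inner_def algebra_simps)

lemma double_curvature_circle_unique:
  assumes "(f, t) \<in> discrete_curves q"
  shows "\<exists>!c. double_curvature_circle f t i c"
proof -
  have fq: "\<llangle>f j, q\<rrangle> = -1" for j
    using assms by (auto simp: discrete_curves_def space_form_def)
  have ne: "f (i - 1) \<noteq> f (i + 1)"
    using assms by (auto simp: discrete_curves_def)
  have ex: "\<exists>c. double_curvature_circle f t i c"
    using assms by (auto simp: discrete_curves_def)
  have "c = c'" if c: "double_curvature_circle f t i c" and c': "double_curvature_circle f t i c'"
    for c c'
  proof -
    obtain a b where ab: "c = t (i - 1) + a *\<^sub>R f (i - 1)" "c = t i + b *\<^sub>R f (i + 1)"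
      using c unfolding double_curvature_circle_def by blast
    obtain a' b' where ab': "c' = t (i - 1) + a' *\<^sub>R f (i - 1)" "c' = t i + b' *\<^sub>R f (i + 1)"
      using c' unfolding double_curvature_circle_def by blast
    have d1: "c - c' = (a - a') *\<^sub>R f (i - 1)"
      unfolding ab(1) ab'(1) by (simp add: scaleR_left_diff_distrib)
    have d2: "c - c' = (b - b') *\<^sub>R f (i + 1)"
      unfolding ab(2) ab'(2) by (simp add: scaleR_left_diff_distrib)
    have "(a - a') * \<llangle>f (i - 1), q\<rrangle> = (b - b') * \<llangle>f (i + 1), q\<rrangle>"
      using d1 d2 by (metis lie_inner_scale_left)
    then have "a - a' = b - b'"
      by (simp add: fq)
    then have "a - a' = 0"
      using d1 d2 ne by (metis scaleR_cancel_left)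
    then show ?thesis
      using d1 by simp
  qed
  then show ?thesis
    using ex by blast
qed

end

theory Submission imports Defs
begin

text \<open>Write \<open>c = t (i - 1) + a f (i - 1) = t i + b f (i + 1)\<close> for the double-curvature circle. Pairing
  with \<open>q\<close> gives \<open>a = b = \<kappa> / 2\<close>, which is the first equation. For the second one, the vectors
  \<open>A = f (i - 1) + f (i + 1) - 2 f i - \<eta>\<^sup>2 (\<llangle>q, q\<rrangle> f i + q)\<close>, \<open>B = t (i - 1) + t i - 2 pp\<close> and
  \<open>u = f (i - 1) - f (i + 1)\<close> lie in the orthogonal complement of \<open>pp\<close>, \<open>q\<close> and \<open>f i\<close>, which is a
  Euclidean plane, and \<open>A\<close> and \<open>B\<close> are orthogonal to \<open>u \<noteq> 0\<close>. Hence the Gram determinant of \<open>A\<close>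
  and \<open>B\<close> vanishes, and this relation makes the difference of the two sides a null vector of the
  plane.\<close>

lemma lie_inner_commute: "\<llangle>x, y\<rrangle> = \<llangle>y, x\<rrangle>"
  by (simp add: lie_inner_def mult.commute)

lemma lie_inner_add_left: "\<llangle>x + y, z\<rrangle> = \<llangle>x, z\<rrangle> + \<llangle>y, z\<rrangle>"
  and lie_inner_diff_left: "\<llangle>x - y, z\<rrangle> = \<llangle>x, z\<rrangle> - \<llangle>y, z\<rrangle>"
  and lie_inner_add_right: "\<llangle>z, x + y\<rrangle> = \<llangle>z, x\<rrangle> + \<llangle>z, y\<rrangle>"
  and lie_inner_diff_right: "\<llangle>z, x - y\<rrangle> = \<llangle>z, x\<rrangle> - \<llangle>z, y\<rrangle>"
  and lie_inner_scale_right: "\<llangle>z, a *\<^sub>R x\<rrangle> = a * \<llangle>z, x\<rrangle>"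
  by (simp_all add: lie_inner_def algebra_simps)

lemmas lie_inner_simps = lie_inner_add_left lie_inner_diff_left lie_inner_scale_left
  lie_inner_add_right lie_inner_diff_right lie_inner_scale_right

text \<open>Numerals of the index type are taken modulo 5, so \<open>5\<close> is its zero; five
  distinct elements exhaust it.\<close>

lemma forall_5: "(\<forall>i::5. P i) \<longleftrightarrow> P 1 \<and> P 2 \<and> P 3 \<and> P 4 \<and> P 5"
proof -
  have "card {1, 2, 3, 4, 5 :: 5} = CARD(5)"
    by simp
  then have "UNIV = {1, 2, 3, 4, 5 :: 5}"
    by (metis card_subset_eq finite top_greatest)
  then show ?thesis
    by (metis UNIV_I empty_iff insert_iff)
qed

lemma lie_inner_pp [simp]: "\<llangle>x, pp\<rrangle> = - x$5"
  by (simp add: lie_inner_def pp_def axis_def)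

section \<open>Euclidean geometry of the tangent plane at a point\<close>

lemma null_vector_point_nth_4:
  assumes "null_vector v" and "\<llangle>v, pp\<rrangle> = 0"
  shows "v$4 \<noteq> 0"
proof
  assume "v$4 = 0"
  moreover have 5: "v$5 = 0"
    using assms(2) by simp
  moreover have "(v$1)\<^sup>2 + (v$2)\<^sup>2 + (v$3)\<^sup>2 = (v$4)\<^sup>2"
    using assms(1) 5 by (auto simp: null_vector_def lie_inner_def power2_eq_square)
  ultimately have "v$1 = 0" "v$2 = 0" "v$3 = 0" "v$4 = 0" "v$5 = 0"
    by (simp_all add: sum_power2_eq_zero_iff add_nonneg_eq_0_iff)
  then have "v = 0"
    by (auto simp: vec_eq_iff forall_5)
  then show False
    using assms by (simp add: null_vector_def)
qed

text \<open>Subtracting a multiple of the null vector \<open>v\<close> to remove the fourth component identifies the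
  quotient of the orthogonal complement of \<open>pp\<close> and \<open>v\<close> by \<open>v\<close> with a plane in Euclidean space.\<close>

definition tangent_proj :: "real^5 \<Rightarrow> real^5 \<Rightarrow> real^3"
  where "tangent_proj v x = vector
    [x$1 - x$4 / v$4 * v$1, x$2 - x$4 / v$4 * v$2, x$3 - x$4 / v$4 * v$3]"

context
  fixes v :: "real^5"
  assumes v: "null_vector v" "\<llangle>v, pp\<rrangle> = 0"
begin

lemma point_nth_5: "v$5 = 0"
  using v(2) by simp

text \<open>Adding multiples of the null vector \<open>v\<close> does not affect products of vectors
  orthogonal to \<open>v\<close>. The shifted vectors have fourth coordinate 0 and \<open>x'\<close>
  has fifth coordinate 0, so only the Euclidean part of the form remains.\<close>

lemma tangent_proj_inner:
  assumes "\<llangle>x, pp\<rrangle> = 0" "\<llangle>x, v\<rrangle> = 0" "\<llangle>y, v\<rrangle> = 0"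
  shows "tangent_proj v x \<bullet> tangent_proj v y = \<llangle>x, y\<rrangle>"
proof -
  define x' y' where "x' = x - (x$4 / v$4) *\<^sub>R v" and "y' = y - (y$4 / v$4) *\<^sub>R v"
  have "tangent_proj v x \<bullet> tangent_proj v y = \<llangle>x', y'\<rrangle>"
    using null_vector_point_nth_4[OF v] point_nth_5 assms(1)[unfolded lie_inner_pp]
    by (simp add: tangent_proj_def inner_vec_def sum_3 lie_inner_def x'_def y'_def)
  also have "\<dots> = \<llangle>x, y\<rrangle>"
    using v(1) assms
    by (simp add: x'_def y'_def lie_inner_simps lie_inner_commute[of v y] null_vector_def)
  finally show ?thesis .
qed

text \<open>The Euclidean image of a null vector is 0, so \<open>x\<close> is a multiple of
  \<open>v\<close>; pairing with \<open>q\<close> shows that the multiple is 0.\<close>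

lemma tangent_null:
  assumes "\<llangle>x, pp\<rrangle> = 0" "\<llangle>x, v\<rrangle> = 0" "\<llangle>x, x\<rrangle> = 0"
    and "\<llangle>x, q\<rrangle> = 0" "\<llangle>v, q\<rrangle> \<noteq> 0"
  shows "x = 0"
proof -
  define k where "k = x$4 / v$4"
  have "tangent_proj v x = 0"
    using tangent_proj_inner[of x x] assms by simp
  then have "x$1 = k * v$1" "x$2 = k * v$2" "x$3 = k * v$3"
    by (simp_all add: tangent_proj_def k_def vec_eq_iff forall_3)
  moreover have "x$4 = k * v$4" "x$5 = k * v$5"
    using null_vector_point_nth_4[OF v] v(2) assms by (simp_all add: k_def)
  ultimately have x: "x = k *\<^sub>R v"
    by (auto simp: vec_eq_iff forall_5)
  then have "k = 0"
    using assms(4,5) by (simp add: lie_inner_scale_left)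
  with x show ?thesis by simp
qed

text \<open>In a Euclidean plane, two vectors orthogonal to the same nonzero vector are parallel, so
  their Gram determinant vanishes.\<close>

lemma tangent_gram_eq_0:
  assumes x: "\<llangle>x, pp\<rrangle> = 0" "\<llangle>x, v\<rrangle> = 0"
    and y: "\<llangle>y, pp\<rrangle> = 0" "\<llangle>y, v\<rrangle> = 0"
    and u: "\<llangle>u, pp\<rrangle> = 0" "\<llangle>u, v\<rrangle> = 0" "\<llangle>u, u\<rrangle> \<noteq> 0"
    and orth: "\<llangle>x, u\<rrangle> = 0" "\<llangle>y, u\<rrangle> = 0"
  shows "\<llangle>x, x\<rrangle> * \<llangle>y, y\<rrangle> = \<llangle>x, y\<rrangle>\<^sup>2"
proof -
  \<comment> \<open>The spatial part of \<open>v\<close> is a normal of the plane that contains all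
    the projections.\<close>
  define n :: "real^3" where "n = vector [v$1, v$2, v$3]"
  let ?X = "tangent_proj v x" and ?Y = "tangent_proj v y" and ?U = "tangent_proj v u"
  have nn: "n \<bullet> n = (v$4)\<^sup>2"
    using v(1) by (simp add: n_def point_nth_5 inner_vec_def sum_3 null_vector_def lie_inner_def power2_eq_square)
  have n: "n \<noteq> 0"
    using nn null_vector_point_nth_4[OF v] by auto
  have perp: "n \<bullet> tangent_proj v z = 0" if "\<llangle>z, v\<rrangle> = 0" for z
  proof -
    have "n \<bullet> tangent_proj v z = \<llangle>z, v\<rrangle> + z$4 * v$4 - z$4 / v$4 * (n \<bullet> n)"
      by (simp add: n_def tangent_proj_def point_nth_5 inner_vec_def sum_3 lie_inner_def algebra_simps)
    then show ?thesis
      using that nn null_vector_point_nth_4[OF v] by (simp add: power2_eq_square)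
  qed
  have U: "?U \<noteq> 0"
    using tangent_proj_inner[of u u] u by auto
  \<comment> \<open>\<open>D\<close> is parallel to the normal \<open>n\<close> and, by the
    orthogonality assumptions, also to \<open>?U\<close>. As \<open>n\<close> and \<open>?U\<close>
    are nonzero and orthogonal, \<open>D\<close> is 0; its squared norm is the Gram
    determinant.\<close>
  define D where "D = cross3 ?X ?Y"
  have Dn: "cross3 n D = 0"
    using perp[of x] perp[of y] x y by (simp add: D_def Lagrange)
  have DU: "cross3 ?U D = 0"
    using tangent_proj_inner[of u x] tangent_proj_inner[of u y] x y u orth
    by (simp add: D_def Lagrange lie_inner_commute)
  have "cross3 n (cross3 ?U D) = (n \<bullet> D) *\<^sub>R ?U - (n \<bullet> ?U) *\<^sub>R D"
    by (simp add: Lagrange)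
  then have "n \<bullet> D = 0"
    using DU U perp[of u] u by simp
  then have "D = 0"
    using Dn n norm_and_cross_eq_0 by blast
  then show ?thesis
    using dot_cross[of ?X ?Y ?X ?Y] tangent_proj_inner x y
    by (simp add: D_def power2_eq_square lie_inner_commute[of y x])
qed

end

section \<open>Curvature and the two Frenet-type equations\<close>

lemma curvature_eq:
  assumes ft: "(f, t) \<in> discrete_curves q"
    and c: "double_curvature_circle f t i (t (i - 1) + a *\<^sub>R f (i - 1))"
  shows "curvature q f t i = 2 * a"
proof -
  have "(THE c. double_curvature_circle f t i c) = t (i - 1) + a *\<^sub>R f (i - 1)"
    using double_curvature_circle_unique[OF ft] c by (rule the1_equality)
  moreover have "\<llangle>t (i - 1), q\<rrangle> = 0" "\<llangle>f (i - 1), q\<rrangle> = -1"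
    using ft by (auto simp: discrete_curves_def geodesic_through_def space_form_def)
  ultimately show ?thesis
    using c by (simp add: curvature_def geodesic_curvature_circle_def lie_inner_simps
        double_curvature_circle_def circle_lift_def)
qed

lemma tangent_difference:
  assumes ft: "(f, t) \<in> discrete_curves q"
  shows "t (i - 1) - t i = - (curvature q f t i / 2) *\<^sub>R (f (i - 1) - f (i + 1))"
proof -
  obtain c where c: "double_curvature_circle f t i c"
    using double_curvature_circle_unique[OF ft] by blast
  then obtain a b where a: "c = t (i - 1) + a *\<^sub>R f (i - 1)" and b: "c = t i + b *\<^sub>R f (i + 1)"
    unfolding double_curvature_circle_def by blast
  have "\<llangle>t j, q\<rrangle> = 0" "\<llangle>f j, q\<rrangle> = -1" for j
    using ft by (auto simp: discrete_curves_def geodesic_through_def space_form_def)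
  then have "\<llangle>c, q\<rrangle> = - a" "\<llangle>c, q\<rrangle> = - b"
    by (simp add: a lie_inner_simps, simp add: b lie_inner_simps)
  then have "t (i - 1) + a *\<^sub>R f (i - 1) = t i + a *\<^sub>R f (i + 1)"
    using a b by simp
  moreover have "curvature q f t i = 2 * a"
    using curvature_eq[OF ft] c a by simp
  ultimately show ?thesis
    by (simp add: algebra_simps)
qed

text \<open>This is the second Frenet-type equation multiplied by \<open>\<eta>\<^sup>2\<close>,
  which clears the denominators of the edge-normals.\<close>

lemma normal_difference:
  fixes q :: "real^5"
  assumes q: "space_form_vector q" and ft: "(f, t) \<in> discrete_curves_eta q \<eta>"
  defines "Q \<equiv> \<llangle>q, q\<rrangle>"
  shows "f (i - 1) + f (i + 1) - 2 *\<^sub>R f i - \<eta>\<^sup>2 *\<^sub>R (Q *\<^sub>R f i + q)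
    = (curvature q f t i / 2 * (\<eta>\<^sup>2 * (1 + Q / 4 * \<eta>\<^sup>2))) *\<^sub>R (t (i - 1) + t i - 2 *\<^sub>R pp)"
proof -
  define g h k where "g = f (i - 1)" and "h = f i" and "k = f (i + 1)"
  define r p where "r = t (i - 1)" and "p = t i"
  define a where "a = curvature q f t i / 2"
  have D: "(f, t) \<in> discrete_curves q" and *: "\<forall>j. \<eta>\<^sup>2 = -2 * \<llangle>f j, f (j + 1)\<rrangle>"
    using ft by (auto simp: discrete_curves_eta_def)
  have eta: "\<llangle>f j, f (j + 1)\<rrangle> = - \<eta>\<^sup>2 / 2" for j
    using spec[OF *, of j] by simp
  have f: "\<llangle>f j, f j\<rrangle> = 0" "\<llangle>f j, pp\<rrangle> = 0" "\<llangle>f j, q\<rrangle> = -1" "null_vector (f j)" for j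
    using D by (auto simp: discrete_curves_def space_form_def null_vector_def)
  have t: "\<llangle>t j, t j\<rrangle> = 0" "\<llangle>t j, pp\<rrangle> = -1" "\<llangle>t j, q\<rrangle> = 0" "\<llangle>t j, f j\<rrangle> = 0" "\<llangle>t j, f (j + 1)\<rrangle> = 0" for j
    using D by (auto simp: discrete_curves_def geodesic_through_def circle_lift_def null_vector_def)
  have gk: "g \<noteq> k"
    using D by (auto simp: discrete_curves_def g_def k_def)
  have pr: "p = r + a *\<^sub>R (g - k)"
    using tangent_difference[OF D, of i]
    by (simp add: p_def r_def a_def g_def k_def algebra_simps)
  \<comment> \<open>All products needed below become polynomials in \<open>s\<close>,
    \<open>a\<close>, \<open>Q\<close> and \<open>\<eta>\<^sup>2\<close>, since \<open>pr\<close>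
    eliminates \<open>p\<close>.\<close>
  define s where "s = \<llangle>g, k\<rrangle>"
  have pq: "\<llangle>pp, pp\<rrangle> = -1" "\<llangle>q, pp\<rrangle> = 0"
    using q lie_inner_commute[of pp q]
    by (simp add: pp_def lie_inner_def axis_def, simp add: space_form_vector_def)
  have null: "\<llangle>g, g\<rrangle> = 0" "\<llangle>h, h\<rrangle> = 0" "\<llangle>k, k\<rrangle> = 0" "\<llangle>r, r\<rrangle> = 0" "\<llangle>p, p\<rrangle> = 0"
    by (simp_all add: f t g_def h_def k_def r_def p_def)
  have with_pp: "\<llangle>g, pp\<rrangle> = 0" "\<llangle>h, pp\<rrangle> = 0" "\<llangle>k, pp\<rrangle> = 0" "\<llangle>r, pp\<rrangle> = -1" "\<llangle>p, pp\<rrangle> = -1"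
    unfolding g_def h_def k_def r_def p_def by (simp_all only: f t)
  have with_q: "\<llangle>g, q\<rrangle> = -1" "\<llangle>h, q\<rrangle> = -1" "\<llangle>k, q\<rrangle> = -1" "\<llangle>r, q\<rrangle> = 0" "\<llangle>p, q\<rrangle> = 0"
    by (simp_all add: f t g_def h_def k_def r_def p_def)
  have with_h: "\<llangle>g, h\<rrangle> = - \<eta>\<^sup>2 / 2" "\<llangle>h, k\<rrangle> = - \<eta>\<^sup>2 / 2" "\<llangle>r, h\<rrangle> = 0" "\<llangle>p, h\<rrangle> = 0"
    using eta[of "i - 1"] eta[of i] t(5)[of "i - 1"]
    by (simp_all add: t g_def h_def k_def r_def p_def)
  have rg: "\<llangle>r, g\<rrangle> = 0" and pk: "\<llangle>p, k\<rrangle> = 0"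
    by (simp_all add: t r_def g_def p_def k_def)
  have rk: "\<llangle>r, k\<rrangle> = - a * s"
    using pk null by (simp add: pr lie_inner_simps s_def)
  have pg: "\<llangle>p, g\<rrangle> = - a * s"
    using rg null by (simp add: pr lie_inner_simps s_def lie_inner_commute[of k g])
  have rp: "\<llangle>r, p\<rrangle> = a\<^sup>2 * s"
    using rg rk null by (simp add: pr lie_inner_simps power2_eq_square)
  note flip = lie_inner_commute[of pp g] lie_inner_commute[of pp h] lie_inner_commute[of pp k]
    lie_inner_commute[of pp r] lie_inner_commute[of pp p] lie_inner_commute[of pp q]
    lie_inner_commute[of q g] lie_inner_commute[of q h] lie_inner_commute[of q k]
    lie_inner_commute[of q r] lie_inner_commute[of q p]
    lie_inner_commute[of h g] lie_inner_commute[of k h] lie_inner_commute[of k g]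
    lie_inner_commute[of h r] lie_inner_commute[of h p]
    lie_inner_commute[of g r] lie_inner_commute[of g p]
    lie_inner_commute[of k r] lie_inner_commute[of k p] lie_inner_commute[of p r]
  note products = lie_inner_simps flip pq null with_pp with_q with_h rg pk rk pg rp
    s_def[symmetric] Q_def[symmetric]
  \<comment> \<open>\<open>Q *\<^sub>R h + q\<close> is orthogonal to \<open>pp\<close> and
    \<open>q\<close> and pairs to -1 with \<open>h\<close>; the correction in \<open>A\<close> thus
    makes the second difference orthogonal to \<open>h\<close> while keeping it orthogonal to
    \<open>pp\<close> and \<open>q\<close>. The claim reads
    \<open>A = (a * \<rho>) *\<^sub>R B\<close>.\<close>
  define u A B where "u = g - k"
    and "A = g + k - 2 *\<^sub>R h - \<eta>\<^sup>2 *\<^sub>R (Q *\<^sub>R h + q)" and "B = r + p - 2 *\<^sub>R pp"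
  define \<rho> where "\<rho> = \<eta>\<^sup>2 * (1 + Q / 4 * \<eta>\<^sup>2)"
  have h: "null_vector h" "\<llangle>h, pp\<rrangle> = 0" "\<llangle>h, q\<rrangle> \<noteq> 0"
    using f(4) with_pp with_q by (simp_all add: h_def)
  have u: "\<llangle>u, pp\<rrangle> = 0" "\<llangle>u, h\<rrangle> = 0" "\<llangle>u, q\<rrangle> = 0" "\<llangle>u, u\<rrangle> = - 2 * s"
    unfolding u_def by (simp_all del: lie_inner_pp add: products)
  have A: "\<llangle>A, pp\<rrangle> = 0" "\<llangle>A, h\<rrangle> = 0" "\<llangle>A, q\<rrangle> = 0" "\<llangle>A, u\<rrangle> = 0" "\<llangle>A, A\<rrangle> = 4 * \<rho> + 2 * s"
    unfolding A_def u_def \<rho>_def by (simp_all del: lie_inner_pp add: products algebra_simps)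
  have B: "\<llangle>B, pp\<rrangle> = 0" "\<llangle>B, h\<rrangle> = 0" "\<llangle>B, q\<rrangle> = 0" "\<llangle>B, u\<rrangle> = 0" "\<llangle>B, B\<rrangle> = 4 + 2 * a\<^sup>2 * s"
    unfolding B_def u_def by (simp_all del: lie_inner_pp add: products algebra_simps)
  have AB: "\<llangle>A, B\<rrangle> = - 2 * a * s"
    unfolding A_def B_def by (simp del: lie_inner_pp add: products algebra_simps)
  have "u \<noteq> 0"
    using gk by (simp add: u_def)
  \<comment> \<open>A nonzero vector of the tangent plane is not null, and \<open>u\<close> has
    square \<open>- 2 * s\<close>.\<close>
  then have s: "s \<noteq> 0"
    using tangent_null[OF h(1,2) u(1,2) _ u(3) h(3)] u(4) by auto
  have "\<llangle>A, A\<rrangle> * \<llangle>B, B\<rrangle> = \<llangle>A, B\<rrangle>\<^sup>2"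
    using s u by (intro tangent_gram_eq_0[OF h(1,2) A(1,2) B(1,2) u(1,2) _ A(4) B(4)]) simp
  then have "8 * (2 * \<rho> + s + a\<^sup>2 * \<rho> * s) = 0"
    by (simp add: A B AB power2_eq_square algebra_simps)
  then have gram: "2 * \<rho> + s + a\<^sup>2 * \<rho> * s = 0"
    by simp
  define X where "X = A - (a * \<rho>) *\<^sub>R B"
  have X: "\<llangle>X, pp\<rrangle> = 0" "\<llangle>X, h\<rrangle> = 0" "\<llangle>X, q\<rrangle> = 0"
    unfolding X_def by (simp_all del: lie_inner_pp add: lie_inner_simps A B)
  \<comment> \<open>The Gram relation is a factor of the square of \<open>X\<close>. This fixes the
    coefficient \<open>a * \<rho>\<close> without dividing by the square of \<open>B\<close>, so
    \<open>B = 0\<close> is no special case.\<close>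
  have "\<llangle>X, X\<rrangle> = 2 * (1 + a\<^sup>2 * \<rho>) * (2 * \<rho> + s + a\<^sup>2 * \<rho> * s)"
    unfolding X_def
    by (simp add: lie_inner_simps lie_inner_commute[of B A] A B AB power2_eq_square algebra_simps)
  then have "\<llangle>X, X\<rrangle> = 0"
    by (simp add: gram)
  then have "X = 0"
    by (rule tangent_null[OF h(1,2) X(1,2) _ X(3) h(3)])
  then show ?thesis
    by (simp add: X_def A_def B_def g_def h_def k_def r_def p_def a_def \<rho>_def)
qed

theorem proposition9:
  fixes q :: "real^5" and \<eta> :: real and f t :: "int \<Rightarrow> real^5"
  assumes "space_form_vector q"
    and "\<eta> > 0"
    and "(f, t) \<in> discrete_curves_eta q \<eta>"
  shows "\<forall>i.
    ((1 / \<eta>) *\<^sub>R (t (i - 1) - t i)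
        = - (curvature q f t i / 2) *\<^sub>R
            (edge_normal \<eta> f (i - 1) + edge_normal \<eta> f i - 2 *\<^sub>R pp)
     \<and> - (curvature q f t i / 2) *\<^sub>R
            (edge_normal \<eta> f (i - 1) + edge_normal \<eta> f i - 2 *\<^sub>R pp)
        = - (curvature q f t i / (2 * \<eta>)) *\<^sub>R (f (i - 1) - f (i + 1)))
    \<and> (1 / \<eta>) *\<^sub>R (edge_normal \<eta> f (i - 1) - edge_normal \<eta> f i
          - \<eta> *\<^sub>R (\<llangle>q, q\<rrangle> *\<^sub>R f i + q))
        = (curvature q f t i / 2 * (1 + \<llangle>q, q\<rrangle> / 4 * \<eta>\<^sup>2)) *\<^sub>R
            (t (i - 1) + t i - 2 *\<^sub>R pp)"
proof -
  have D: "(f, t) \<in> discrete_curves q"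
    using assms(3) by (auto simp: discrete_curves_eta_def)
  show ?thesis
  proof (intro allI conjI)
    fix i
    let ?\<kappa> = "curvature q f t i" and ?Q = "\<llangle>q, q\<rrangle>"
    \<comment> \<open>The middle vertex telescopes away and the copies of \<open>pp\<close>
      cancel.\<close>
    have n: "edge_normal \<eta> f (i - 1) + edge_normal \<eta> f i - 2 *\<^sub>R pp
        = (1 / \<eta>) *\<^sub>R (f (i - 1) - f (i + 1))"
      by (simp add: edge_normal_def scaleR_2 algebra_simps)
    show *: "- (?\<kappa> / 2) *\<^sub>R (edge_normal \<eta> f (i - 1) + edge_normal \<eta> f i - 2 *\<^sub>R pp)
        = - (?\<kappa> / (2 * \<eta>)) *\<^sub>R (f (i - 1) - f (i + 1))"
      unfolding n by simp
    show "(1 / \<eta>) *\<^sub>R (t (i - 1) - t i)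
        = - (?\<kappa> / 2) *\<^sub>R (edge_normal \<eta> f (i - 1) + edge_normal \<eta> f i - 2 *\<^sub>R pp)"
      unfolding * tangent_difference[OF D] by simp
    \<comment> \<open>Here \<open>pp\<close> cancels in the difference of the normals, leaving the
      second difference of \<open>f\<close>; the factor \<open>\<eta>\<^sup>2\<close> is cancelled
      at the end because \<open>\<eta>\<close> is positive.\<close>
    have "\<eta>\<^sup>2 *\<^sub>R ((1 / \<eta>) *\<^sub>R (edge_normal \<eta> f (i - 1) - edge_normal \<eta> f i
          - \<eta> *\<^sub>R (?Q *\<^sub>R f i + q)))
        = f (i - 1) + f (i + 1) - 2 *\<^sub>R f i - \<eta>\<^sup>2 *\<^sub>R (?Q *\<^sub>R f i + q)"
      using assms(2) by (simp add: edge_normal_def scaleR_2 power2_eq_square algebra_simps)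
    also have "\<dots> = \<eta>\<^sup>2 *\<^sub>R ((?\<kappa> / 2 * (1 + ?Q / 4 * \<eta>\<^sup>2)) *\<^sub>R (t (i - 1) + t i - 2 *\<^sub>R pp))"
      unfolding normal_difference[OF assms(1,3)] by (simp add: algebra_simps)
    finally show "(1 / \<eta>) *\<^sub>R (edge_normal \<eta> f (i - 1) - edge_normal \<eta> f i
          - \<eta> *\<^sub>R (?Q *\<^sub>R f i + q))
        = (?\<kappa> / 2 * (1 + ?Q / 4 * \<eta>\<^sup>2)) *\<^sub>R (t (i - 1) + t i - 2 *\<^sub>R pp)"
      using assms(2) by (metis scaleR_cancel_left less_irrefl power_not_zero)
  qed
qed

end
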